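(* Let $A$ be a stable matrix. Suppose that there is a positive (semi-)definite matrix $Z$ satisfying the inequality $\mathcal{Q}(Z)\ge 0$ and an initial matrix $X_0$ such that $X_0\ge Z$ and $\mathcal{Q}(X_0)\le 0$, where $$\mathcal{Q}(X)=AX+XA^\top+D+MXM^\top+(GXG^\top)\circ(FXF^\top).$$ Then the fixed-point iteration $$AX_{k+1}+X_{k+1}A^\top=-(GX_kG^\top)\circ(FX_kF^\top)-MX_kM^\top-D$$ produces a matrix sequence $\{X_k\}$ such that for $k\ge 0$: 1. $X_k\ge X_{k+1}$, $X_k\ge Z$, $\mathcal{Q}(X_k)\le 0$; 2. $\lim_{k\to\infty}X_k=X^\ast$ is a positive (semi-)definite solution to the equation $\mathcal{Q}(X)=0$. Especially, $X^\ast$ is the maximal solution if $X_0$ is an upper bound for all solutions.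
   Context: Here $A,M,F,G\in\mathbb{R}^{N\times N}$, $D=BB^\top$ with $B$ a vector of order $N$, and $\circ$ denotes the Hadamard product of matrices. A matrix is called stable if its spectrum lies in the open left half of the complex plane. For symmetric matrices $P$ and $Q$, $P\ge Q$ means that $P-Q$ is symmetric positive semidefinite, and $P\le Q$ means $Q\ge P$. "Solution" means a solution of $\mathcal{Q}(X)=0$; "upper bound" and "maximal" are with respect to the order $\ge$.
   Formalization: "The maximal solution" cannot mean X* ≥ every symmetric solution, as that fails for a 2×2 example; proved instead: X* is a maximal element among symmetric solutions if X_0 bounds them all, and X* is the greatest positive semidefinite solution if X_0 bounds all positive semidefinite solutions. *)

theory Defs
  imports "HOL-Analysis.Analysis"
begin

definition spectrum :: "real^'n^'n \<Rightarrow> complex set" where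
  "spectrum A = {z. \<exists>v :: complex^'n. v \<noteq> 0 \<and> map_matrix complex_of_real A *v v = z *s v}"

definition stable_matrix :: "real^'n^'n \<Rightarrow> bool" where
  "stable_matrix A \<longleftrightarrow> (\<forall>z \<in> spectrum A. Re z < 0)"

definition symmetric :: "real^'n^'n \<Rightarrow> bool" where
  "symmetric P \<longleftrightarrow> transpose P = P"

definition psd :: "real^'n^'n \<Rightarrow> bool" where
  "psd P \<longleftrightarrow> symmetric P \<and> (\<forall>v. v \<bullet> (P *v v) \<ge> 0)"

definition pd :: "real^'n^'n \<Rightarrow> bool" where
  "pd P \<longleftrightarrow> symmetric P \<and> (\<forall>v. v \<noteq> 0 \<longrightarrow> v \<bullet> (P *v v) > 0)"

text \<open>The order is a relation between symmetric matrices only. The relation \<open>\<ge>\<close> that the library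
  provides on \<open>real^'n^'n\<close> is the entrywise one.\<close>

definition loewner_ge :: "real^'n^'n \<Rightarrow> real^'n^'n \<Rightarrow> bool"  (infix "\<succeq>" 50) where
  "P \<succeq> Q \<longleftrightarrow> symmetric P \<and> symmetric Q \<and> psd (P - Q)"

abbreviation loewner_le :: "real^'n^'n \<Rightarrow> real^'n^'n \<Rightarrow> bool"  (infix "\<preceq>" 50) where
  "P \<preceq> Q \<equiv> Q \<succeq> P"

text \<open>The library's \<open>*\<close> on vectors is componentwise, so on matrices it is the product of the
  entries; it is spelled out here for definiteness.\<close>

definition hadamard :: "real^'n^'n \<Rightarrow> real^'n^'n \<Rightarrow> real^'n^'n"  (infixl "\<circ>\<^sub>H" 70) where
  "P \<circ>\<^sub>H Q = (\<chi> i j. P $ i $ j * Q $ i $ j)"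

definition outer :: "real^'n \<Rightarrow> real^'n^'n" where
  "outer B = (\<chi> i j. B $ i * B $ j)"  \<comment> \<open>\<open>B B\<^sup>T\<close>\<close>

definition Qop :: "real^'n^'n \<Rightarrow> real^'n \<Rightarrow> real^'n^'n \<Rightarrow> real^'n^'n \<Rightarrow> real^'n^'n
    \<Rightarrow> real^'n^'n \<Rightarrow> real^'n^'n" where
  "Qop A B M F G X =
     A ** X + X ** transpose A + outer B + M ** X ** transpose M
     + (G ** X ** transpose G) \<circ>\<^sub>H (F ** X ** transpose F)"

text \<open>A matrix comparable to another one under \<open>\<succeq>\<close> is symmetric, so the solutions that can be
  bounded above are the symmetric ones.\<close>

definition solutions :: "real^'n^'n \<Rightarrow> real^'n \<Rightarrow> real^'n^'n \<Rightarrow> real^'n^'n \<Rightarrow> real^'n^'n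
    \<Rightarrow> (real^'n^'n) set" where
  "solutions A B M F G = {X. symmetric X \<and> Qop A B M F G X = 0}"

definition psd_solutions :: "real^'n^'n \<Rightarrow> real^'n \<Rightarrow> real^'n^'n \<Rightarrow> real^'n^'n \<Rightarrow> real^'n^'n
    \<Rightarrow> (real^'n^'n) set" where
  "psd_solutions A B M F G = {X. psd X \<and> Qop A B M F G X = 0}"

definition is_upper_bound :: "real^'n^'n \<Rightarrow> (real^'n^'n) set \<Rightarrow> bool" where
  "is_upper_bound P S \<longleftrightarrow> (\<forall>Y \<in> S. P \<succeq> Y)"

text \<open>A "maximal solution" may mean a maximal element or, as is usual for Riccati-type equations,
  a greatest element. Among all symmetric solutions only the first can be claimed: for
  \<open>N = 2\<close>, \<open>A = - I / 2\<close>, \<open>B = 0\<close>, \<open>M = diag(sqrt 2, 0)\<close>, \<open>F = G = [[1,0],[1,0]]\<close> the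
  solutions are \<open>0\<close> and the indefinite \<open>Y = [[-1,1],[1,1]]\<close>; with \<open>Z = 0\<close> the matrix
  \<open>X\<^sub>0 = diag(0,2)\<close> satisfies all hypotheses and bounds both solutions, but the iteration gives
  \<open>X\<^sub>1 = 0\<close>, which is not \<open>\<succeq> Y\<close>. Among the positive semidefinite solutions the limit is
  the greatest element.\<close>

definition is_maximal :: "real^'n^'n \<Rightarrow> (real^'n^'n) set \<Rightarrow> bool" where
  "is_maximal P S \<longleftrightarrow> P \<in> S \<and> (\<forall>Y \<in> S. Y \<succeq> P \<longrightarrow> Y = P)"

definition is_greatest :: "real^'n^'n \<Rightarrow> (real^'n^'n) set \<Rightarrow> bool" where
  "is_greatest P S \<longleftrightarrow> P \<in> S \<and> is_upper_bound P S"

definition fixed_point_sequence :: "real^'n^'n \<Rightarrow> real^'n \<Rightarrow> real^'n^'n \<Rightarrow> real^'n^'n \<Rightarrow> real^'n^'n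
    \<Rightarrow> real^'n^'n \<Rightarrow> (nat \<Rightarrow> real^'n^'n) \<Rightarrow> bool" where
  "fixed_point_sequence A B M F G X0 X \<longleftrightarrow>
     X 0 = X0 \<and>
     (\<forall>k. A ** X (Suc k) + X (Suc k) ** transpose A =
        - ((G ** X k ** transpose G) \<circ>\<^sub>H (F ** X k ** transpose F))
        - M ** X k ** transpose M - outer B)"

end

theory Submission
  imports Defs "HOL-Computational_Algebra.Fundamental_Theorem_Algebra"
begin

text \<open>Subtracting consecutive equations of the iteration expresses the image of
  \<open>X\<^sub>k - X\<^sub>k\<^sub>+\<^sub>1\<close> and of \<open>X\<^sub>k - Y\<close> under the Lyapunov operator \<open>X \<mapsto> A X + X A\<^sup>T\<close>
  by \<open>Q(X\<^sub>k)\<close>, \<open>Q(Y)\<close> and increments of the nonlinear part. The latter is monotone on positive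
  semidefinite matrices by the Schur product theorem, and for stable \<open>A\<close> the negative of the Lyapunov
  operator reflects positive semidefiniteness, so the sequence decreases and stays above every positive
  semidefinite \<open>Y \<le> X\<^sub>0\<close> with \<open>Q(Y) \<ge> 0\<close>.

  For the Lyapunov operator, the exponential \<open>exp(t A\<^sup>T)\<close> is replaced by powers of the Cayley
  transform \<open>C = (I + A\<^sup>T)(I - A\<^sup>T)\<^sup>-\<^sup>1\<close>: they tend to 0, and \<open>x \<bullet> X x\<close> does not increase
  along \<open>x, C x, C\<^sup>2 x, \<dots>\<close> if \<open>A X + X A\<^sup>T \<le> 0\<close>, so it is nonnegative. A symmetric
  solution above the limit is itself positive semidefinite, hence also below the limit; this gives
  maximality among all symmetric solutions.\<close>

subsection \<open>Powers of the Cayley transform\<close>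

text \<open>Summability is stronger than the convergence to 0 wanted in the end, but a contraction
  recurrence passes it on by mere summation.\<close>

definition orbit_summable :: "complex^'n^'n \<Rightarrow> complex^'n \<Rightarrow> bool" where
  "orbit_summable C x \<longleftrightarrow> summable (\<lambda>n. norm (((*v) C ^^ n) x))"

lemma funpow_mult_vec_add:
  fixes C :: "'a::field^'n^'n"
  shows "((*v) C ^^ n) (x + y) = ((*v) C ^^ n) x + ((*v) C ^^ n) y"
  by (induction n) (simp_all add: matrix_vector_right_distrib)

lemma funpow_mult_vec_scale:
  fixes C :: "'a::field^'n^'n"
  shows "((*v) C ^^ n) (c *s x) = c *s ((*v) C ^^ n) x"
  by (induction n) (simp_all add: vector_scalar_commute)

lemma funpow_mult_vec_commute:
  fixes C S :: "'a::field^'n^'n"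
  assumes "C ** S = S ** C"
  shows "((*v) C ^^ n) (S *v x) = S *v ((*v) C ^^ n) x"
  by (induction n) (simp_all add: matrix_vector_mul_assoc assms)

lemma norm_vector_scalar_mult: "norm (c *s x) = cmod c * norm x" for x :: "complex^'n"
  by (simp add: norm_vec_def L2_set_right_distrib norm_mult)

lemma orbit_summable_zero: "orbit_summable C 0"
proof -
  have "((*v) C ^^ n) 0 = 0" for n by (induction n) simp_all
  then show ?thesis by (simp add: orbit_summable_def)
qed

lemma orbit_summable_add:
  assumes "orbit_summable C x" "orbit_summable C y"
  shows "orbit_summable C (x + y)"
  unfolding orbit_summable_def
proof (rule summable_comparison_test')
  show "summable (\<lambda>n. norm (((*v) C ^^ n) x) + norm (((*v) C ^^ n) y))"
    using assms by (auto simp: orbit_summable_def intro: summable_add)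
  show "norm (norm (((*v) C ^^ n) (x + y))) \<le> norm (((*v) C ^^ n) x) + norm (((*v) C ^^ n) y)"
    if "n \<ge> 0" for n
    by (simp add: funpow_mult_vec_add norm_triangle_ineq)
qed

lemma orbit_summable_scale:
  "orbit_summable C x \<Longrightarrow> orbit_summable C (c *s x)"
  by (simp add: orbit_summable_def funpow_mult_vec_scale norm_vector_scalar_mult summable_mult)

text \<open>The orbit of \<open>S *v x\<close> is the image under \<open>S\<close> of the orbit of
  \<open>x\<close>, so norms grow at most by the operator norm of \<open>S\<close>.\<close>

lemma orbit_summable_commute:
  fixes C S :: "complex^'n^'n"
  assumes "orbit_summable C x" "C ** S = S ** C"
  shows "orbit_summable C (S *v x)"
  unfolding orbit_summable_def
proof (rule summable_comparison_test')
  show "summable (\<lambda>n. norm (((*v) C ^^ n) x) * onorm ((*v) S))"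
    using assms by (auto simp: orbit_summable_def intro: summable_mult2)
  show "norm (norm (((*v) C ^^ n) (S *v x))) \<le> norm (((*v) C ^^ n) x) * onorm ((*v) S)"
    if "n \<ge> 0" for n
    using onorm[OF matrix_vector_mul_bounded_linear[of S]]
    by (subst mult.commute) (simp add: funpow_mult_vec_commute[OF assms(2)])
qed

text \<open>Summing the recurrence bounds a partial sum \<open>s\<close> by
  \<open>a 0 + r * s + suminf b\<close>, which can be solved for \<open>s\<close> because r <
  1.\<close>

lemma summable_contraction_recurrence:
  fixes a b :: "nat \<Rightarrow> real"
  assumes nn: "\<And>n. a n \<ge> 0" "\<And>n. b n \<ge> 0"
    and rec: "\<And>n. a (Suc n) \<le> r * a n + b n"
    and b: "summable b" and r: "0 \<le> r" "r < 1"
  shows "summable a"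
proof (rule summableI_nonneg_bounded)
  fix n
  have "(\<Sum>i<Suc n. a i) = a 0 + (\<Sum>i<n. a (Suc i))"
    by (rule sum.lessThan_Suc_shift)
  also have "\<dots> \<le> a 0 + (\<Sum>i<n. r * a i + b i)"
    by (intro add_left_mono sum_mono rec)
  also have "\<dots> = a 0 + r * (\<Sum>i<n. a i) + (\<Sum>i<n. b i)"
    by (simp add: sum.distrib sum_distrib_left)
  also have "(\<Sum>i<n. b i) \<le> suminf b"
    using b nn by (intro sum_le_suminf) auto
  \<comment> \<open>The left side still contains the last term \<open>a n\<close>, which is
    nonnegative and is dropped.\<close>
  finally have "(\<Sum>i<n. a i) * (1 - r) \<le> a 0 + suminf b"
    using nn(1)[of n] by (simp add: algebra_simps)
  then show "(\<Sum>i<n. a i) \<le> (a 0 + suminf b) / (1 - r)"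
    using r by (simp add: field_simps)
qed (use nn in auto)

text \<open>Modulo the vectors with summable orbit, \<open>C\<close> multiplies \<open>y\<close> by
  a number of modulus below 1.\<close>

lemma orbit_summable_contraction:
  assumes "cmod \<mu> < 1" and "C *v y = \<mu> *s y + w" and "orbit_summable C w"
  shows "orbit_summable C y"
  unfolding orbit_summable_def
proof (rule summable_contraction_recurrence)
  show "norm (((*v) C ^^ Suc n) y) \<le> cmod \<mu> * norm (((*v) C ^^ n) y) + norm (((*v) C ^^ n) w)" for n
  proof -
    have "((*v) C ^^ Suc n) y = ((*v) C ^^ n) (\<mu> *s y + w)"
      by (simp only: funpow_Suc_right o_apply assms(2))
    also have "\<dots> = \<mu> *s ((*v) C ^^ n) y + ((*v) C ^^ n) w"
      by (simp only: funpow_mult_vec_add funpow_mult_vec_scale)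
    finally show ?thesis
      by (metis norm_triangle_ineq norm_vector_scalar_mult)
  qed
qed (use assms in \<open>auto simp: orbit_summable_def\<close>)

section \<open>Matrix identities and inverses\<close>

lemma invertible_iff_trivial_kernel:
  fixes A :: "'a::field^'n^'n"
  shows "invertible A \<longleftrightarrow> (\<forall>v. A *v v = 0 \<longrightarrow> v = 0)"
  by (simp add: invertible_left_inverse matrix_left_invertible_injective vec.inj_iff_eq_0)

lemma matrix_mult_mat_commute: "mat c ** E = E ** mat c" for E :: "'a::field^'n^'n"
  by (simp add: matrix_matrix_mult_def mat_def vec_eq_iff if_distrib if_distribR mult.commute cong: if_cong)

lemma mat_mult_vec: "mat c *v x = c *s x" for x :: "'a::field^'n"
  by (simp add: matrix_vector_mult_def mat_def vec_eq_iff if_distrib if_distribR cong: if_cong)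

lemma matrix_add_rdistrib: "(A + B) ** C = A ** C + B ** C" for A :: "'a::ring_1^'n^'m"
  by (simp add: matrix_eq matrix_vector_mult_add_rdistrib flip: matrix_vector_mul_assoc)

lemma matrix_sub_ldistrib: "A ** (B - C) = A ** B - A ** C" for A :: "'a::ring_1^'n^'m"
  by (simp add: matrix_eq matrix_vector_mult_diff_rdistrib matrix_vector_mult_diff_distrib
      flip: matrix_vector_mul_assoc)

lemma matrix_sub_rdistrib: "(A - B) ** C = A ** C - B ** C" for A :: "'a::ring_1^'n^'m"
  by (simp add: matrix_eq matrix_vector_mult_diff_rdistrib flip: matrix_vector_mul_assoc)

lemma commute_left_inverse:
  fixes S T C :: "'a::field^'n^'n"
  assumes "S ** T = mat 1" "T ** S = mat 1" "C ** T = T ** C"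
  shows "C ** S = S ** C"
proof -
  have "S ** (C ** T) ** S = S ** (T ** C) ** S" using assms(3) by simp
  then have "S ** C ** (T ** S) = (S ** T) ** C ** S" by (simp only: matrix_mul_assoc)
  then show ?thesis by (simp add: assms)
qed

section \<open>Polynomials in a matrix, evaluated at a vector\<close>

definition poly_action :: "'a::field^'n^'n \<Rightarrow> 'a^'n \<Rightarrow> 'a poly \<Rightarrow> 'a^'n" where
  "poly_action E x p = fold_coeffs (\<lambda>a v. a *s x + E *v v) p 0"

lemma poly_action_0 [simp]: "poly_action E x 0 = 0"
  by (simp add: poly_action_def)

lemma poly_action_pCons [simp]: "poly_action E x (pCons a p) = a *s x + E *v poly_action E x p"
proof (cases "p = 0")
  case True
  then show ?thesis by (cases "a = 0") (simp_all add: poly_action_def)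
next
  case False
  then show ?thesis by (simp add: poly_action_def)
qed

lemma poly_action_add: "poly_action E x (p + q) = poly_action E x p + poly_action E x q"
  by (induction p q rule: poly_induct2) (simp_all add: matrix_vector_right_distrib vec.scale_left_distrib)

lemma poly_action_smult: "poly_action E x (smult c p) = c *s poly_action E x p"
  by (induction p) (simp_all add: vector_scalar_commute vec.scale_right_distrib)

lemma poly_action_monom: "poly_action E x (monom c n) = c *s ((*v) E ^^ n) x"
  by (induction n) (simp_all add: monom_0 monom_Suc vector_scalar_commute)

lemma poly_action_sum: "poly_action E x (\<Sum>i\<in>I. f i) = (\<Sum>i\<in>I. poly_action E x (f i))"
  by (induction I rule: infinite_finite_induct) (simp_all add: poly_action_add)

lemma poly_action_linear_factor:
  "poly_action E x ([:- z, 1:] * q) = (E - mat z) *v poly_action E x q"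
proof -
  have "[:- z, 1:] * q = smult (- z) q + pCons 0 q" by simp
  then show ?thesis
    by (simp only: poly_action_add poly_action_smult poly_action_pCons)
       (simp add: matrix_vector_mult_diff_rdistrib mat_mult_vec)
qed

text \<open>Among x, E x, ..., E^d x, with d the real dimension of the space, either two vectors
  coincide or there is a nontrivial linear relation with real coefficients.\<close>

lemma exists_annihilating_poly:
  fixes E :: "complex^'n^'n" and x :: "complex^'n"
  obtains p where "p \<noteq> 0" "poly_action E x p = 0"
proof -
  let ?v = "\<lambda>i. ((*v) E ^^ i) x"
  let ?I = "{..DIM(complex^'n)}"
  show ?thesis
  proof (cases "inj_on ?v ?I")
    case False
    then obtain i j where ij: "i \<noteq> j" "?v i = ?v j" by (auto simp: inj_on_def)
    have "monom 1 i + monom (-1) j \<noteq> (0 :: complex poly)"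
      using ij by (auto simp: poly_eq_iff coeff_monom dest!: spec[of _ i])
    moreover have "poly_action E x (monom 1 i + monom (-1) j) = 0"
      using ij by (simp add: poly_action_add poly_action_monom vec_eq_iff)
    ultimately show ?thesis using that by blast
  next
    case True
    then have "card (?v ` ?I) > DIM(complex^'n)" by (simp add: card_image)
    then have "dependent (?v ` ?I)"
      by (intro dependent_biggerset) auto
    then obtain u where u: "\<exists>v\<in>?v ` ?I. u v \<noteq> 0" "(\<Sum>v\<in>?v ` ?I. u v *\<^sub>R v) = 0"
      using real_vector.dependent_finite[of "?v ` ?I"] by auto
    define p where "p = (\<Sum>i\<in>?I. monom (complex_of_real (u (?v i))) i)"
    from u obtain k where k: "k \<in> ?I" "u (?v k) \<noteq> 0" by auto
    have "coeff p k = complex_of_real (u (?v k))"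
      using k by (simp add: p_def coeff_sum coeff_monom)
    then have "p \<noteq> 0" using k by auto
    moreover have "poly_action E x p = (\<Sum>i\<in>?I. u (?v i) *\<^sub>R ?v i)"
      unfolding p_def poly_action_sum poly_action_monom
      by (intro sum.cong) (simp_all add: vec_eq_iff scaleR_conv_of_real[where 'a = complex])
    moreover have "\<dots> = 0"
      using u(2) sum.reindex[OF True, of "\<lambda>v. u v *\<^sub>R v"] by simp
    ultimately show ?thesis using that by simp
  qed
qed

text \<open>Over the complex numbers \<open>p\<close> has a root as long as it is not constant, and
  \<open>cancel\<close> removes the linear factors one by one. The nonzero constant that remains is
  undone by \<open>scale\<close>.\<close>

lemma cancel_poly_action:
  fixes E :: "complex^'n^'n"
  assumes scale: "\<And>c y. W y \<Longrightarrow> W (c *s y)"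
    and cancel: "\<And>z y. W ((E - mat z) *v y) \<Longrightarrow> W y"
    and "p \<noteq> 0" "W (poly_action E x p)"
  shows "W x"
  using assms(3,4)
proof (induction "degree p" arbitrary: p)
  case 0
  then obtain a where a: "p = [:a:]" "a \<noteq> 0" by (auto elim: degree_eq_zeroE)
  with 0 have "W (inverse a *s (a *s x))" by (intro scale[of "a *s x"]) simp
  with a show ?case by (simp add: vec.scale_scale)
next
  case (Suc n)
  then obtain z where "poly p z = 0"
    using alg_closed_imp_poly_has_root[of p] by auto
  then obtain q where q: "p = [:- z, 1:] * q" using poly_eq_0_iff_dvd by blast
  with Suc have "q \<noteq> 0" by auto
  then have "degree p = Suc (degree q)"
    unfolding q by (subst degree_mult_eq) auto
  moreover have "W (poly_action E x q)"
    using Suc(4) cancel unfolding q poly_action_linear_factor by blast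
  ultimately show ?case using Suc \<open>q \<noteq> 0\<close> by auto
qed

text \<open>The squared moduli of 1 + z and 1 - z differ by 4 Re z.\<close>

lemma cmod_cayley_less_1:
  assumes "Re z < 0"
  shows "cmod ((1 + z) / (1 - z)) < 1"
proof -
  have "1 - z \<noteq> 0" using assms by (auto simp: complex_eq_iff)
  have "(cmod (1 + z))\<^sup>2 < (cmod (1 - z))\<^sup>2"
    using assms unfolding cmod_power2 by (simp add: power2_eq_square algebra_simps)
  then have "cmod (1 + z) < cmod (1 - z)" by (rule power_less_imp_less_base) simp
  then show ?thesis using \<open>1 - z \<noteq> 0\<close> by (simp add: norm_divide)
qed

text \<open>\<open>E\<close> commutes with its Cayley transform, so the vectors with summable orbit form an
  \<open>E\<close>-invariant subspace. It admits cancellation of every factor \<open>E - z\<close>: if \<open>Re z < 0\<close> then modulo the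
  subspace the Cayley transform acts on a \<open>z\<close>-eigenvector as a contraction, and otherwise \<open>E - z\<close> is
  invertible.\<close>

lemma cayley_orbit_summable:
  fixes E R :: "complex^'n^'n"
  assumes spec: "\<And>z v. v \<noteq> 0 \<Longrightarrow> E *v v = z *s v \<Longrightarrow> Re z < 0"
    and R: "(mat 1 - E) ** R = mat 1" "R ** (mat 1 - E) = mat 1"
  shows "orbit_summable ((mat 1 + E) ** R) x"
proof -
  define C where "C = (mat 1 + E) ** R"
  \<comment> \<open>\<open>R\<close> is the inverse of I - E and so commutes with \<open>E\<close>;
    hence \<open>C\<close>, \<open>E\<close> and \<open>R\<close> all commute.\<close>
  have ER: "E ** R = R ** E"
    by (rule commute_left_inverse[OF R(2,1)])
       (simp add: matrix_add_ldistrib matrix_sub_ldistrib matrix_sub_rdistrib)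
  have CR: "C ** R = R ** C"
    unfolding C_def
    by (metis ER matrix_add_ldistrib matrix_add_rdistrib matrix_mul_assoc matrix_mul_lid matrix_mul_rid)
  have CE: "C ** E = E ** C"
    unfolding C_def
    by (metis ER matrix_add_ldistrib matrix_add_rdistrib matrix_mul_assoc matrix_mul_lid matrix_mul_rid)
  have cancel: "orbit_summable C y" if w: "orbit_summable C ((E - mat z) *v y)" for z y
  proof (cases "Re z < 0")
    case True
    define w where "w = (E - mat z) *v y"
    have z: "1 - z \<noteq> 0" using True by (auto simp: complex_eq_iff)
    have Ey: "E *v y = z *s y + w"
      by (simp add: w_def matrix_vector_mult_diff_rdistrib mat_mult_vec)
    \<comment> \<open>Solving for \<open>R *v y\<close> expresses it through \<open>y\<close> and
      \<open>R *v w\<close>. This brings \<open>C *v y\<close> into the form required by the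
      contraction lemma.\<close>
    have "y = R *v ((mat 1 - E) *v y)" by (simp add: matrix_vector_mul_assoc R)
    also have "(mat 1 - E) *v y = (1 - z) *s y - w"
      by (simp add: matrix_vector_mult_diff_rdistrib Ey vec_eq_iff algebra_simps)
    finally have y: "y = (1 - z) *s (R *v y) - R *v w"
      by (simp add: matrix_vector_mult_diff_distrib vector_scalar_commute)
    have "u = inverse c *s (x + t)" if "x = c *s u - t" "c \<noteq> 0" for x u t :: "complex^'n" and c
      using that by simp
    from this[OF y z] have Ry: "R *v y = inverse (1 - z) *s (y + R *v w)" .
    have "C *v y = R *v ((mat 1 + E) *v y)"
      unfolding C_def
      by (metis ER matrix_add_ldistrib matrix_add_rdistrib matrix_mul_lid matrix_mul_rid matrix_vector_mul_assoc)
    also have "\<dots> = (1 + z) *s (R *v y) + R *v w"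
      by (simp add: matrix_vector_mult_add_rdistrib Ey matrix_vector_right_distrib vector_scalar_commute
          vec_eq_iff algebra_simps)
    also have "\<dots> = ((1 + z) / (1 - z)) *s y + (((1 + z) / (1 - z)) *s (R *v w) + R *v w)"
      by (simp add: Ry vec_eq_iff field_simps)
    finally show ?thesis
    proof (rule orbit_summable_contraction[OF cmod_cayley_less_1[OF True]])
      have "orbit_summable C (R *v w)"
        using w orbit_summable_commute[OF _ CR] by (simp add: w_def)
      then show "orbit_summable C (((1 + z) / (1 - z)) *s (R *v w) + R *v w)"
        by (intro orbit_summable_add orbit_summable_scale)
    qed
  next
    case False
    have "v = 0" if "(E - mat z) *v v = 0" for v
      using spec[of v z] that False by (auto simp: matrix_vector_mult_diff_rdistrib mat_mult_vec)
    then have "invertible (E - mat z)" by (simp add: invertible_iff_trivial_kernel)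
    then obtain S where S: "S ** (E - mat z) = mat 1" "(E - mat z) ** S = mat 1"
      by (auto simp: invertible_def)
    have "C ** S = S ** C"
      by (rule commute_left_inverse[OF S])
         (simp add: matrix_sub_ldistrib matrix_sub_rdistrib CE matrix_mult_mat_commute)
    from orbit_summable_commute[OF w this] show ?thesis
      by (simp add: matrix_vector_mul_assoc S)
  qed
  \<comment> \<open>The zero vector has a summable orbit, and cancellation leads from it back to
    \<open>x\<close>.\<close>
  obtain p where "p \<noteq> 0" "poly_action E x p = 0" by (rule exists_annihilating_poly)
  then have "orbit_summable C x"
    using cancel_poly_action[of "orbit_summable C" E p x, OF orbit_summable_scale cancel]
    by (simp add: orbit_summable_zero)
  then show ?thesis by (simp add: C_def)
qed

subsection \<open>The Lyapunov operator\<close>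

lemma map_matrix_of_real_mult_vec:
  "map_matrix complex_of_real A *v (\<chi> i. complex_of_real (x $ i)) = (\<chi> i. complex_of_real ((A *v x) $ i))"
  by (simp add: matrix_vector_mult_def vec_eq_iff)

lemma map_matrix_of_real_mult:
  "map_matrix complex_of_real (A ** B) = map_matrix complex_of_real A ** map_matrix complex_of_real B"
  by (simp add: matrix_matrix_mult_def vec_eq_iff)

lemma map_matrix_of_real_mat: "map_matrix complex_of_real (mat c) = mat (complex_of_real c)"
  by (simp add: mat_def vec_eq_iff)

lemma map_matrix_of_real_add:
  "map_matrix complex_of_real (A + B) = map_matrix complex_of_real A + map_matrix complex_of_real B"
  by (simp add: vec_eq_iff)

lemma map_matrix_of_real_diff:
  "map_matrix complex_of_real (A - B) = map_matrix complex_of_real A - map_matrix complex_of_real B"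
  by (simp add: vec_eq_iff)

text \<open>In this form the spectrum visibly agrees with that of the transpose.\<close>

lemma spectrum_iff_not_invertible:
  "z \<in> spectrum A \<longleftrightarrow> \<not> invertible (map_matrix complex_of_real A - mat z)"
  by (auto simp: spectrum_def invertible_iff_trivial_kernel matrix_vector_mult_diff_rdistrib mat_mult_vec)

lemma invertible_transpose_iff:
  fixes A :: "'a::field^'n^'n"
  shows "invertible (transpose A) \<longleftrightarrow> invertible A"
proof -
  have "invertible (transpose A)" if "invertible A" for A :: "'a^'n^'n"
    using that unfolding invertible_def by (metis matrix_transpose_mul transpose_mat)
  from this[of A] this[of "transpose A"] show ?thesis by auto
qed

lemma transpose_diff: "transpose (A - B) = transpose A - transpose B" for A :: "'a::ab_group_add^'n^'m"
  by (simp add: transpose_def vec_eq_iff)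

lemma transpose_add: "transpose (A + B) = transpose A + transpose B" for A :: "'a::ab_group_add^'n^'m"
  by (simp add: transpose_def vec_eq_iff)

lemma spectrum_transpose: "spectrum (transpose A) = spectrum A"
proof -
  have "map_matrix complex_of_real (transpose A) - mat z = transpose (map_matrix complex_of_real A - mat z)" for z
    by (auto simp: transpose_def vec_eq_iff mat_def)
  then show ?thesis
    by (simp add: set_eq_iff spectrum_iff_not_invertible invertible_transpose_iff)
qed

lemma stable_matrix_cayley:
  assumes "stable_matrix E"
  obtains R where "(mat 1 - E) ** R = mat 1"
    and "\<And>x. (\<lambda>n. ((*v) ((mat 1 + E) ** R) ^^ n) x) \<longlonglongrightarrow> 0"
proof -
  let ?c = "\<lambda>x :: real^'n. \<chi> i. complex_of_real (x $ i)"
  let ?m = "map_matrix complex_of_real :: real^'n^'n \<Rightarrow> _"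
  have spec: "Re z < 0" if "v \<noteq> 0" "?m E *v v = z *s v" for z v
    using assms that by (auto simp: stable_matrix_def spectrum_def)
  \<comment> \<open>A nonzero kernel vector would be an eigenvector for the eigenvalue 1, which
    stability excludes.\<close>
  have "v = 0" if "(mat 1 - E) *v v = 0" for v
  proof (rule ccontr)
    assume "v \<noteq> 0"
    then have "?c v \<noteq> 0" by (simp add: vec_eq_iff)
    moreover have "E *v v = v" using that by (simp add: matrix_vector_mult_diff_rdistrib)
    then have "?m E *v ?c v = 1 *s ?c v" by (simp add: map_matrix_of_real_mult_vec)
    ultimately show False using spec by fastforce
  qed
  then have "invertible (mat 1 - E)" by (simp add: invertible_iff_trivial_kernel)
  then obtain R where R: "(mat 1 - E) ** R = mat 1" "R ** (mat 1 - E) = mat 1"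
    by (auto simp: invertible_def)
  have R': "(mat 1 - ?m E) ** ?m R = mat 1" "?m R ** (mat 1 - ?m E) = mat 1"
    using R[THEN arg_cong[of _ _ ?m]]
    by (simp_all add: map_matrix_of_real_mult map_matrix_of_real_diff map_matrix_of_real_mat)
  have C: "?m ((mat 1 + E) ** R) = (mat 1 + ?m E) ** ?m R"
    by (simp add: map_matrix_of_real_mult map_matrix_of_real_add map_matrix_of_real_mat)
  have "(\<lambda>n. ((*v) ((mat 1 + E) ** R) ^^ n) x) \<longlonglongrightarrow> 0" for x
  proof -
    have "((*v) (?m ((mat 1 + E) ** R)) ^^ n) (?c x) = ?c (((*v) ((mat 1 + E) ** R) ^^ n) x)" for n
      by (induction n) (simp_all add: map_matrix_of_real_mult_vec)
    moreover have "orbit_summable ((mat 1 + ?m E) ** ?m R) (?c x)"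
      by (rule cayley_orbit_summable[OF spec R'])
    ultimately have "(\<lambda>n. ?c (((*v) ((mat 1 + E) ** R) ^^ n) x)) \<longlonglongrightarrow> 0"
      unfolding orbit_summable_def by (auto dest!: summable_LIMSEQ_zero simp: tendsto_norm_zero_iff C)
    then have "(\<lambda>n. Re (?c (((*v) ((mat 1 + E) ** R) ^^ n) x) $ i)) \<longlonglongrightarrow> Re (0 $ i)" for i
      by (intro tendsto_Re tendsto_vec_nth)
    then show ?thesis by (intro vec_tendstoI) simp
  qed
  with R(1) show ?thesis by (rule that)
qed

section \<open>Injectivity and positivity for the Lyapunov operator\<close>

definition lyapunov :: "real^'n^'n \<Rightarrow> real^'n^'n \<Rightarrow> real^'n^'n" where
  "lyapunov A X = A ** X + X ** transpose A"

lemma lyapunov_add: "lyapunov A (X + Y) = lyapunov A X + lyapunov A Y"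
  by (simp add: lyapunov_def matrix_add_ldistrib matrix_add_rdistrib)

lemma lyapunov_diff: "lyapunov A (X - Y) = lyapunov A X - lyapunov A Y"
  by (simp add: lyapunov_def matrix_sub_ldistrib matrix_sub_rdistrib)

lemma transpose_lyapunov: "transpose (lyapunov A X) = lyapunov A (transpose X)"
  by (simp add: lyapunov_def matrix_transpose_mul transpose_add)

lemma linear_lyapunov: "linear (lyapunov A)"
  by (rule linearI) (simp_all add: lyapunov_add, simp add: lyapunov_def scaleR_add_right
      matrix_scalar_ac scalar_matrix_assoc)

lemma inner_transpose_mult_vec: "x \<bullet> (transpose A *v y) = (A *v x) \<bullet> y" for x :: "real^'n"
  by (metis dot_lmul_matrix inner_commute transpose_matrix_vector)

text \<open>\<open>R\<close> is the inverse of \<open>I - A\<^sup>T\<close> and \<open>C\<close> the Cayley transform \<open>(I + A\<^sup>T) R\<close>.\<close>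

lemma stable_matrix_lyapunov_orbit:
  assumes "stable_matrix A"
  shows "\<exists>C R.
    (\<forall>x y X. (\<lambda>n. ((*v) C ^^ n) x \<bullet> (X *v ((*v) C ^^ n) y)) \<longlonglongrightarrow> 0) \<and>
    (\<forall>x y X. (C *v x) \<bullet> (X *v (C *v y)) = x \<bullet> (X *v y) + 2 * ((R *v x) \<bullet> (lyapunov A X *v (R *v y))))"
proof -
  define E where "E = transpose A"
  have A: "A = transpose E" by (simp add: E_def)
  have "stable_matrix E"
    using assms by (simp add: stable_matrix_def E_def spectrum_transpose)
  then obtain R where R: "(mat 1 - E) ** R = mat 1"
      and lim: "\<And>x. (\<lambda>n. ((*v) ((mat 1 + E) ** R) ^^ n) x) \<longlonglongrightarrow> 0"
    using stable_matrix_cayley by blast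
  define C where "C = (mat 1 + E) ** R"
  have 1: "(\<lambda>n. ((*v) C ^^ n) x \<bullet> (X *v ((*v) C ^^ n) y)) \<longlonglongrightarrow> 0" for x y X
    using tendsto_inner[OF lim[of x] bounded_linear.tendsto[OF matrix_vector_mul_bounded_linear[of X] lim[of y]]]
    by (simp add: C_def)
  have 2: "(C *v x) \<bullet> (X *v (C *v y)) = x \<bullet> (X *v y) + 2 * ((R *v x) \<bullet> (lyapunov A X *v (R *v y)))" for x y X
  proof -
    \<comment> \<open>In terms of \<open>u\<close>, the map \<open>C\<close> flips a sign: it takes
      u - E u to u + E u, and likewise for \<open>w\<close>. The two bilinear forms thus differ by
      twice the mixed terms, which make up the form of \<open>lyapunov A X\<close>.\<close>
    define u where "u = R *v x"
    define w where "w = R *v y"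
    have x: "x = u - E *v u"
      by (metis R matrix_vector_mul_assoc matrix_vector_mul_lid matrix_vector_mult_diff_rdistrib u_def)
    have y: "y = w - E *v w"
      by (metis R matrix_vector_mul_assoc matrix_vector_mul_lid matrix_vector_mult_diff_rdistrib w_def)
    have Cx: "C *v x = u + E *v u"
      by (simp add: C_def u_def matrix_vector_mult_add_rdistrib flip: matrix_vector_mul_assoc)
    have Cy: "C *v y = w + E *v w"
      by (simp add: C_def w_def matrix_vector_mult_add_rdistrib flip: matrix_vector_mul_assoc)
    have "u \<bullet> (lyapunov A X *v w) = (E *v u) \<bullet> (X *v w) + u \<bullet> (X *v (E *v w))"
      unfolding lyapunov_def A matrix_vector_mult_add_rdistrib matrix_vector_mul_assoc[symmetric] inner_add_right
        inner_transpose_mult_vec by simp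
    then show ?thesis
      unfolding Cx Cy u_def[symmetric] w_def[symmetric] unfolding x y
      by (simp add: algebra_simps inner_add_left inner_diff_left inner_add_right inner_diff_right)
  qed
  from 1 2 show ?thesis by blast
qed

text \<open>The bilinear form of \<open>X\<close> is constant along the orbits of \<open>C\<close>
  and also tends to 0.\<close>

lemma lyapunov_eq_0_imp_0:
  assumes "stable_matrix A" "lyapunov A X = 0"
  shows "X = 0"
proof -
  obtain C R where lim: "\<And>x y X. (\<lambda>n. ((*v) C ^^ n) x \<bullet> (X *v ((*v) C ^^ n) y)) \<longlonglongrightarrow> 0"
    and step: "\<And>x y X. (C *v x) \<bullet> (X *v (C *v y)) = x \<bullet> (X *v y) + 2 * ((R *v x) \<bullet> (lyapunov A X *v (R *v y)))"
    using stable_matrix_lyapunov_orbit[OF assms(1)] by blast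
  have "x \<bullet> (X *v y) = 0" for x y
  proof -
    have "((*v) C ^^ n) x \<bullet> (X *v ((*v) C ^^ n) y) = x \<bullet> (X *v y)" for n
      by (induction n) (simp_all add: step assms)
    with lim[of x X y] show ?thesis by (simp add: LIMSEQ_const_iff)
  qed
  \<comment> \<open>With \<open>X *v y\<close> as first argument the value is the squared norm of
    \<open>X *v y\<close>.\<close>
  from this[of "X *v y" y for y] show ?thesis by (simp add: matrix_eq)
qed

text \<open>The correction term in the orbit identity now has a sign, so the initial value bounds
  the sequence, and with it the limit 0, from above.\<close>

lemma lyapunov_nonpos_imp_nonneg:
  assumes "stable_matrix A" "\<And>x. x \<bullet> (lyapunov A X *v x) \<le> 0"
  shows "x \<bullet> (X *v x) \<ge> 0"
proof -
  obtain C R where lim: "\<And>x y X. (\<lambda>n. ((*v) C ^^ n) x \<bullet> (X *v ((*v) C ^^ n) y)) \<longlonglongrightarrow> 0"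
    and step: "\<And>x y X. (C *v x) \<bullet> (X *v (C *v y)) = x \<bullet> (X *v y) + 2 * ((R *v x) \<bullet> (lyapunov A X *v (R *v y)))"
    using stable_matrix_lyapunov_orbit[OF assms(1)] by blast
  have "((*v) C ^^ n) x \<bullet> (X *v ((*v) C ^^ n) x) \<le> x \<bullet> (X *v x)" for n
  proof (induction n)
    case (Suc n)
    have "((*v) C ^^ Suc n) x \<bullet> (X *v ((*v) C ^^ Suc n) x) \<le> ((*v) C ^^ n) x \<bullet> (X *v ((*v) C ^^ n) x)"
      using assms(2)[of "R *v ((*v) C ^^ n) x"] by (simp add: step)
    with Suc show ?case by linarith
  qed simp
  with lim[of x X x] show ?thesis by (intro LIMSEQ_le_const2) auto
qed

lemma inj_lyapunov:
  assumes "stable_matrix A"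
  shows "inj (lyapunov A)"
  using lyapunov_eq_0_imp_0[OF assms] by (simp add: linear_injective_0[OF linear_lyapunov])

lemma surj_lyapunov:
  assumes "stable_matrix A"
  shows "surj (lyapunov A)"
  by (rule linear_inj_imp_surj[OF linear_lyapunov inj_lyapunov[OF assms]])

text \<open>\<open>X\<close> and its transpose have the same image under an injective
  operator.\<close>

lemma symmetric_lyapunov_imp_symmetric:
  assumes "stable_matrix A" "symmetric (lyapunov A X)"
  shows "symmetric X"
  using assms(2) inj_lyapunov[OF assms(1)]
  by (auto simp: symmetric_def transpose_lyapunov dest: injD)

lemma psd_uminus_lyapunov_imp_psd:
  assumes "stable_matrix A" "psd (- lyapunov A X)"
  shows "psd X"
proof -
  have neg: "- lyapunov A X *v v = - (lyapunov A X *v v)" for v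
    by (metis diff_0 matrix_vector_mult_0 matrix_vector_mult_diff_rdistrib)
  have "symmetric (lyapunov A X)"
    using assms(2) by (simp add: psd_def symmetric_def transpose_def vec_eq_iff)
  moreover have "x \<bullet> (X *v x) \<ge> 0" for x
    by (rule lyapunov_nonpos_imp_nonneg[OF assms(1)]) (use assms(2) in \<open>simp add: psd_def neg\<close>)
  ultimately show ?thesis
    using symmetric_lyapunov_imp_symmetric[OF assms(1)] by (simp add: psd_def)
qed

subsection \<open>The Schur product theorem\<close>

lemma psd_0: "psd 0"
  by (simp add: psd_def symmetric_def transpose_def vec_eq_iff)

lemma psd_add:
  assumes "psd P" "psd Q"
  shows "psd (P + Q)"
  using assms by (simp add: psd_def symmetric_def transpose_add matrix_vector_mult_add_rdistrib inner_add_right)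

lemma symmetric_add: "symmetric P \<Longrightarrow> symmetric Q \<Longrightarrow> symmetric (P + Q)"
  by (simp add: symmetric_def transpose_add)

lemma symmetric_nth: "symmetric P \<Longrightarrow> P $ i $ j = P $ j $ i"
  by (simp add: symmetric_def transpose_def vec_eq_iff)

lemma psd_imp_symmetric: "psd P \<Longrightarrow> symmetric P"
  by (simp add: psd_def)

lemma psd_congruence:
  assumes "psd X"
  shows "psd (G ** X ** transpose G)"
proof -
  have "v \<bullet> ((G ** X ** transpose G) *v v) = (transpose G *v v) \<bullet> (X *v (transpose G *v v))" for v
    unfolding matrix_vector_mul_assoc[symmetric] using inner_transpose_mult_vec[of v "transpose G"] by simp
  moreover have "symmetric (G ** X ** transpose G)"
    using assms by (simp add: psd_def symmetric_def matrix_transpose_mul matrix_mul_assoc)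
  ultimately show ?thesis using assms by (simp add: psd_def)
qed

lemma inner_axis_mult_vec_axis: "axis i 1 \<bullet> (P *v axis j 1) = P $ i $ j" for P :: "real^'n^'m"
  by (simp add: inner_axis' matrix_vector_mult_basis column_def)

lemma inner_mult_vec_eq_sum: "v \<bullet> (P *v v) = (\<Sum>i\<in>UNIV. \<Sum>j\<in>UNIV. v $ i * P $ i $ j * v $ j)"
  for P :: "real^'n^'n"
  by (simp add: inner_vec_def matrix_vector_mult_def sum_distrib_left mult.assoc)

lemma psd_diagonal_nonneg: "psd P \<Longrightarrow> P $ i $ i \<ge> 0"
  by (simp add: psd_def flip: inner_axis_mult_vec_axis)

text \<open>With a vanishing diagonal the form at e_i + c e_j is linear in c; nonnegativity for both
  signs of c kills the coefficient.\<close>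

lemma psd_diagonal_0_imp_0:
  assumes "psd P" "\<And>i. P $ i $ i = 0"
  shows "P = 0"
proof -
  have "P $ i $ j = 0" for i j
  proof -
    have "0 \<le> (axis i 1 + c *\<^sub>R axis j 1) \<bullet> (P *v (axis i 1 + c *\<^sub>R axis j 1))" for c
      using assms by (simp add: psd_def)
    also have "\<dots> c = c * (P $ i $ j + P $ j $ i)" for c
      by (simp add: matrix_vector_right_distrib matrix_vector_mult_scaleR inner_add_left inner_add_right
          inner_axis_mult_vec_axis assms algebra_simps)
    finally have "0 \<le> c * (2 * P $ i $ j)" for c
      using symmetric_nth[OF psd_imp_symmetric[OF assms(1)], of i j] by simp
    from this[of 1] this[of "-1"] show ?thesis by simp
  qed
  then show ?thesis by (simp add: vec_eq_iff)
qed

text \<open>One step of Gaussian elimination splits off a rank-one term from a positive semidefinite matrix.\<close>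

lemma psd_eliminate:
  assumes "psd Q" "Q $ k $ k > 0"
  shows "psd (\<chi> i j. Q $ i $ j - Q $ i $ k * Q $ j $ k / Q $ k $ k)" (is "psd ?R")
  unfolding psd_def
proof
  let ?q = "Q $ k $ k"
  note Q_sym = symmetric_nth[OF psd_imp_symmetric[OF assms(1)]]
  show "symmetric ?R"
    using Q_sym by (simp add: symmetric_def transpose_def vec_eq_iff mult.commute)
  show "\<forall>v. v \<bullet> (?R *v v) \<ge> 0"
  proof
    fix v :: "real^'a"
    define c where "c = Q *v axis k 1"
    have c: "c $ i = Q $ i $ k" for i
      by (simp add: c_def matrix_vector_mult_basis column_def)
    have "(Q *v v) $ k = v \<bullet> c"
      by (simp add: matrix_vector_mult_def inner_vec_def c Q_sym[of k] mult.commute)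
    then have "axis k 1 \<bullet> (Q *v v) = v \<bullet> c" by (simp add: inner_axis')
    \<comment> \<open>\<open>t\<close> minimizes the form at v - t e_k; the minimum is the form of
      the eliminated matrix at \<open>v\<close>.\<close>
    moreover define t where "t = (v \<bullet> c) / ?q"
    ultimately have "(v - t *\<^sub>R axis k 1) \<bullet> (Q *v (v - t *\<^sub>R axis k 1)) = v \<bullet> (Q *v v) - 2 * t * (v \<bullet> c) + t * t * ?q"
      by (simp add: matrix_vector_mult_diff_distrib matrix_vector_mult_scaleR inner_diff_left inner_diff_right
          inner_axis_mult_vec_axis algebra_simps flip: c_def) (simp add: inner_axis' c)
    also have "\<dots> = v \<bullet> (Q *v v) - (v \<bullet> c)\<^sup>2 / ?q"
      using assms(2) by (simp add: t_def field_simps power2_eq_square)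
    also have "\<dots> = v \<bullet> (?R *v v)"
    proof -
      have "(v \<bullet> c)\<^sup>2 / ?q = (\<Sum>i\<in>UNIV. \<Sum>j\<in>UNIV. v $ i * (Q $ i $ k * Q $ j $ k / ?q) * v $ j)"
        by (simp add: inner_vec_def c power2_eq_square sum_product sum_divide_distrib mult_ac)
      then show ?thesis
        by (simp add: inner_mult_vec_eq_sum right_diff_distrib left_diff_distrib sum_subtractf)
    qed
    finally have "v \<bullet> (?R *v v) = (v - t *\<^sub>R axis k 1) \<bullet> (Q *v (v - t *\<^sub>R axis k 1))" by (rule sym)
    also have "\<dots> \<ge> 0"
      using assms(1) unfolding psd_def by blast
    finally show "v \<bullet> (?R *v v) \<ge> 0" .
  qed
qed

text \<open>Induction on the number of nonzero diagonal entries of \<open>Q\<close>: elimination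
  writes \<open>Q\<close> as a matrix \<open>R\<close> with fewer of them plus a rank-one term. The
  Hadamard product of \<open>P\<close> with that term rescales the rows and columns of
  \<open>P\<close>.\<close>

lemma psd_hadamard:
  assumes "psd P" "psd Q"
  shows "psd (P \<circ>\<^sub>H Q)"
  using assms(2)
proof (induction "card {i. Q $ i $ i \<noteq> 0}" arbitrary: Q rule: less_induct)
  case less
  show ?case
  proof (cases "\<forall>i. Q $ i $ i = 0")
    case True
    with psd_diagonal_0_imp_0[OF less.prems] have "P \<circ>\<^sub>H Q = 0" by (simp add: hadamard_def vec_eq_iff)
    then show ?thesis by (simp add: psd_0)
  next
    case False
    then obtain k where "Q $ k $ k \<noteq> 0" by auto
    with psd_diagonal_nonneg[OF less.prems, of k] have k: "Q $ k $ k > 0" by simp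
    define R where "R = (\<chi> i j. Q $ i $ j - Q $ i $ k * Q $ j $ k / Q $ k $ k)"
    define S where "S = (\<chi> i j. P $ i $ j * (Q $ i $ k * Q $ j $ k / Q $ k $ k))"
    have "psd R" unfolding R_def by (rule psd_eliminate[OF less.prems k])
    have "R $ k $ k = 0" using k by (simp add: R_def)
    \<comment> \<open>Elimination can only lower diagonal entries, and those of \<open>R\<close>
      remain nonnegative.\<close>
    moreover have "R $ i $ i = 0" if "Q $ i $ i = 0" for i
    proof -
      have "R $ i $ i \<le> 0" using that k by (simp add: R_def)
      with psd_diagonal_nonneg[OF \<open>psd R\<close>, of i] show ?thesis by simp
    qed
    ultimately have "{i. R $ i $ i \<noteq> 0} \<subset> {i. Q $ i $ i \<noteq> 0}"
      using \<open>Q $ k $ k \<noteq> 0\<close> by blast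
    then have "card {i. R $ i $ i \<noteq> 0} < card {i. Q $ i $ i \<noteq> 0}"
      by (intro psubset_card_mono) auto
    with \<open>psd R\<close> have "psd (P \<circ>\<^sub>H R)" by (rule less.hyps[rotated])
    moreover have "psd S"
      unfolding psd_def
    proof (intro conjI allI)
      show "symmetric S"
        using symmetric_nth[OF psd_imp_symmetric[OF assms(1)]]
        by (simp add: symmetric_def transpose_def vec_eq_iff S_def mult.commute)
      fix v :: "real^'a"
      \<comment> \<open>Absorbing column \<open>k\<close> of \<open>Q\<close> into the vector turns
        the form of \<open>S\<close> into that of \<open>P\<close>, up to the pivot.\<close>
      define w where "w = (\<chi> i. v $ i * Q $ i $ k)"
      have "v \<bullet> (S *v v) = (w \<bullet> (P *v w)) / Q $ k $ k"
        by (simp add: inner_mult_vec_eq_sum S_def w_def sum_divide_distrib mult_ac)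
      then show "v \<bullet> (S *v v) \<ge> 0"
        using assms(1) k by (simp add: psd_def)
    qed
    moreover have "P \<circ>\<^sub>H Q = P \<circ>\<^sub>H R + S"
      by (simp add: hadamard_def R_def S_def vec_eq_iff algebra_simps)
    ultimately show ?thesis by (simp add: psd_add)
  qed
qed

subsection \<open>The fixed-point iteration\<close>

definition nonlinear_part where
  "nonlinear_part M F G X = M ** X ** transpose M + (G ** X ** transpose G) \<circ>\<^sub>H (F ** X ** transpose F)"

lemma Qop_eq: "Qop A B M F G X = lyapunov A X + outer B + nonlinear_part M F G X"
  by (simp add: Qop_def lyapunov_def nonlinear_part_def)

text \<open>Changing one Hadamard factor at a time leaves only products of positive semidefinite
  congruences, to which the Schur product theorem applies.\<close>

lemma psd_nonlinear_part_diff: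
  assumes "psd Y" "psd (X - Y)"
  shows "psd (nonlinear_part M F G X - nonlinear_part M F G Y)"
proof -
  have "psd X" using psd_add[OF assms] by simp
  have "nonlinear_part M F G X - nonlinear_part M F G Y =
      M ** (X - Y) ** transpose M
      + (G ** (X - Y) ** transpose G) \<circ>\<^sub>H (F ** X ** transpose F)
      + (G ** Y ** transpose G) \<circ>\<^sub>H (F ** (X - Y) ** transpose F)"
    unfolding nonlinear_part_def matrix_sub_ldistrib matrix_sub_rdistrib
    by (simp add: hadamard_def vec_eq_iff algebra_simps)
  then show ?thesis
    using assms \<open>psd X\<close> by (auto intro!: psd_add psd_hadamard psd_congruence)
qed

lemma fixed_point_sequence_iff:
  "fixed_point_sequence A B M F G X0 X \<longleftrightarrow>
     X 0 = X0 \<and> (\<forall>k. lyapunov A (X (Suc k)) = - nonlinear_part M F G (X k) - outer B)"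
  by (simp add: fixed_point_sequence_def lyapunov_def nonlinear_part_def minus_diff_commute)

lemma ex1_fixed_point_sequence:
  assumes "stable_matrix A"
  shows "\<exists>!X. fixed_point_sequence A B M F G X0 X"
proof
  define X where "X = rec_nat X0 (\<lambda>_ Y. inv (lyapunov A) (- nonlinear_part M F G Y - outer B))"
  show "fixed_point_sequence A B M F G X0 X"
    by (simp add: fixed_point_sequence_iff X_def surj_f_inv_f[OF surj_lyapunov[OF assms]])
  show "Y = X" if Y: "fixed_point_sequence A B M F G X0 Y" for Y
  proof
    show "Y k = X k" for k
    proof (induction k)
      case 0
      then show ?case using Y by (simp add: fixed_point_sequence_iff X_def)
    next
      case (Suc k)
      then have "lyapunov A (Y (Suc k)) = lyapunov A (X (Suc k))"
        using Y \<open>fixed_point_sequence A B M F G X0 X\<close> by (simp add: fixed_point_sequence_iff)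
      then show ?case by (rule injD[OF inj_lyapunov[OF assms]])
    qed
  qed
qed

lemma fixed_point_sequence_ge:
  assumes stable: "stable_matrix A" and X: "fixed_point_sequence A B M F G X0 X"
    and Y: "psd Y" "psd (Qop A B M F G Y)" "psd (X0 - Y)"
  shows "psd (X k - Y)"
proof (induction k)
  case 0
  then show ?case using X Y by (simp add: fixed_point_sequence_iff)
next
  case (Suc k)
  have "- lyapunov A (X (Suc k) - Y) =
      (nonlinear_part M F G (X k) - nonlinear_part M F G Y) + Qop A B M F G Y"
    using X by (simp add: fixed_point_sequence_iff lyapunov_diff Qop_eq)
  with Suc Y have "psd (- lyapunov A (X (Suc k) - Y))"
    by (simp only: psd_add psd_nonlinear_part_diff)
  then show ?case by (rule psd_uminus_lyapunov_imp_psd[OF stable])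
qed

text \<open>The two claims feed each other: Q(X_k) is the Lyapunov image of X_k - X_{k+1}, so its
  sign gives the decrease; the decrease makes Q(X_{k+1}) a nonpositive increment of the nonlinear
  part.\<close>

lemma fixed_point_sequence_decreasing:
  assumes stable: "stable_matrix A" and X: "fixed_point_sequence A B M F G X0 X"
    and "psd (- Qop A B M F G X0)" and X_psd: "\<And>k. psd (X k)"
  shows "psd (X k - X (Suc k))" and "psd (- Qop A B M F G (X k))"
proof -
  have step: "psd (X k - X (Suc k))" if "psd (- Qop A B M F G (X k))" for k
  proof (rule psd_uminus_lyapunov_imp_psd[OF stable])
    have "lyapunov A (X k - X (Suc k)) = Qop A B M F G (X k)"
      using X by (simp add: fixed_point_sequence_iff lyapunov_diff Qop_eq)
    with that show "psd (- lyapunov A (X k - X (Suc k)))" by simp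
  qed
  show Q: "psd (- Qop A B M F G (X k))" for k
  proof (induction k)
    case 0
    then show ?case using assms by (simp add: fixed_point_sequence_iff)
  next
    case (Suc k)
    have "- Qop A B M F G (X (Suc k)) = nonlinear_part M F G (X k) - nonlinear_part M F G (X (Suc k))"
      using X by (simp add: fixed_point_sequence_iff Qop_eq)
    then show ?case
      using psd_nonlinear_part_diff[OF X_psd step[OF Suc]] by simp
  qed
  show "psd (X k - X (Suc k))" by (rule step[OF Q])
qed

section \<open>Convergence and passage to the limit\<close>

lemma convergent_decreasing_psd:
  assumes "\<And>k. symmetric (X k)" "\<And>k. psd (X k - X (Suc k))" "\<And>k. psd (X k - Z)"
  obtains L where "X \<longlonglongrightarrow> L"
proof -
  \<comment> \<open>At each vector the quadratic forms decrease and are bounded below by that of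
    \<open>Z\<close>.\<close>
  have form: "convergent (\<lambda>k. v \<bullet> (X k *v v))" for v
  proof -
    have "decseq (\<lambda>k. v \<bullet> (X k *v v))"
      using assms(2) by (intro decseq_SucI) (simp add: psd_def matrix_vector_mult_diff_rdistrib inner_diff_right)
    moreover have "v \<bullet> (X k *v v) \<ge> v \<bullet> (Z *v v)" for k
      using assms(3) by (simp add: psd_def matrix_vector_mult_diff_rdistrib inner_diff_right)
    ultimately show ?thesis
      by (metis convergentI decseq_convergent)
  qed
  have "convergent (\<lambda>k. X k $ i $ j)" for i j
  proof -
    \<comment> \<open>Polarization recovers the entries of a symmetric matrix from its quadratic
      form.\<close>
    have "X k $ i $ j = ((axis i 1 + axis j 1) \<bullet> (X k *v (axis i 1 + axis j 1))
        - axis i 1 \<bullet> (X k *v axis i 1) - axis j 1 \<bullet> (X k *v axis j 1)) / 2" for k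
      using symmetric_nth[OF assms(1), of k i j]
      by (simp add: matrix_vector_right_distrib inner_add_left inner_add_right inner_axis_mult_vec_axis)
    then show ?thesis
      by (simp only: divide_inverse) (intro convergent_mult convergent_diff convergent_const form)
  qed
  then have "(\<lambda>k. X k $ i $ j) \<longlonglongrightarrow> lim (\<lambda>k. X k $ i $ j)" for i j
    by (simp add: convergent_LIMSEQ_iff)
  then have "X \<longlonglongrightarrow> (\<chi> i j. lim (\<lambda>k. X k $ i $ j))"
    by (intro vec_tendstoI) simp
  then show ?thesis by (rule that)
qed

lemma psd_limit:
  assumes "X \<longlonglongrightarrow> L" "\<And>k. psd (X k)"
  shows "psd L"
proof -
  have entry: "(\<lambda>k. X k $ i $ j) \<longlonglongrightarrow> L $ i $ j" for i j
    by (intro tendsto_vec_nth assms(1))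
  have "L $ i $ j = L $ j $ i" for i j
    using entry[of j i] symmetric_nth[OF psd_imp_symmetric[OF assms(2)], of _ i j]
    by (intro LIMSEQ_unique[OF entry]) simp
  moreover have "0 \<le> v \<bullet> (L *v v)" for v
  proof (rule LIMSEQ_le_const)
    show "(\<lambda>k. v \<bullet> (X k *v v)) \<longlonglongrightarrow> v \<bullet> (L *v v)"
      unfolding inner_mult_vec_eq_sum by (intro tendsto_intros entry)
  qed (use assms(2) in \<open>auto simp: psd_def\<close>)
  ultimately show ?thesis by (simp add: psd_def symmetric_def transpose_def vec_eq_iff)
qed

lemma tendsto_matrix_mult [tendsto_intros]:
  fixes X :: "'b \<Rightarrow> real^'n^'m" and Y :: "'b \<Rightarrow> real^'p^'n"
  assumes "(X \<longlongrightarrow> P) \<F>" "(Y \<longlongrightarrow> Q) \<F>"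
  shows "((\<lambda>k. X k ** Y k) \<longlongrightarrow> P ** Q) \<F>"
  unfolding matrix_matrix_mult_def
  by (intro vec_tendstoI) (auto intro!: tendsto_intros assms)

lemma tendsto_hadamard [tendsto_intros]:
  assumes "(X \<longlongrightarrow> P) \<F>" "(Y \<longlongrightarrow> Q) \<F>"
  shows "((\<lambda>k. X k \<circ>\<^sub>H Y k) \<longlongrightarrow> P \<circ>\<^sub>H Q) \<F>"
  unfolding hadamard_def
  by (intro vec_tendstoI) (auto intro!: tendsto_intros assms)

lemma fixed_point_sequence_limit:
  assumes X: "fixed_point_sequence A B M F G X0 X" and lim: "X \<longlonglongrightarrow> L"
  shows "Qop A B M F G L = 0"
proof -
  have "(\<lambda>k. lyapunov A (X (Suc k))) \<longlonglongrightarrow> lyapunov A L"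
    unfolding lyapunov_def by (intro tendsto_intros LIMSEQ_Suc[OF lim])
  moreover have "(\<lambda>k. lyapunov A (X (Suc k))) \<longlonglongrightarrow> - nonlinear_part M F G L - outer B"
    using X unfolding fixed_point_sequence_iff nonlinear_part_def
    by (simp only: conjunct2) (intro tendsto_intros lim)
  ultimately have "lyapunov A L = - nonlinear_part M F G L - outer B"
    by (rule LIMSEQ_unique)
  then show ?thesis by (simp add: Qop_eq)
qed

section \<open>The Loewner order\<close>

lemma loewner_ge_0_iff: "P \<succeq> 0 \<longleftrightarrow> psd P"
  using psd_imp_symmetric[OF psd_0] by (auto simp: loewner_ge_def psd_def)

lemma loewner_le_0_iff: "P \<preceq> 0 \<longleftrightarrow> psd (- P)"
proof -
  have "symmetric P \<longleftrightarrow> symmetric (- P)"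
    by (simp add: symmetric_def transpose_def vec_eq_iff)
  then show ?thesis
    using psd_imp_symmetric[OF psd_0] by (auto simp: loewner_ge_def psd_def)
qed

lemma loewner_geI: "symmetric Q \<Longrightarrow> psd (P - Q) \<Longrightarrow> P \<succeq> Q"
  using symmetric_add[of "P - Q" Q] by (auto simp: loewner_ge_def psd_def)

lemma loewner_ge_psd: "P \<succeq> Q \<Longrightarrow> psd Q \<Longrightarrow> psd P"
  using psd_add[of "P - Q" Q] by (simp add: loewner_ge_def)

lemma loewner_ge_pd:
  assumes "P \<succeq> Q" "pd Q"
  shows "pd P"
  unfolding pd_def
proof (intro conjI allI impI)
  show "symmetric P" using assms by (simp add: loewner_ge_def)
  show "v \<bullet> (P *v v) > 0" if "v \<noteq> 0" for v
  proof -
    have "v \<bullet> (P *v v) \<ge> v \<bullet> (Q *v v)"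
      using assms(1) by (simp add: loewner_ge_def psd_def matrix_vector_mult_diff_rdistrib inner_diff_right)
    moreover have "v \<bullet> (Q *v v) > 0" using assms(2) that by (simp add: pd_def)
    ultimately show ?thesis by linarith
  qed
qed

text \<open>The diagonals of P - Q and Q - P are both nonnegative, hence zero, which forces a
  positive semidefinite matrix to vanish.\<close>

lemma loewner_ge_antisym:
  assumes "P \<succeq> Q" "Q \<succeq> P"
  shows "P = Q"
proof -
  have "(P - Q) $ i $ i = 0" for i
    using psd_diagonal_nonneg[of "P - Q" i] psd_diagonal_nonneg[of "Q - P" i] assms
    by (simp add: loewner_ge_def)
  then have "P - Q = 0"
    using assms by (intro psd_diagonal_0_imp_0) (auto simp: loewner_ge_def)
  then show ?thesis by simp
qed

theorem theorem3p1:
  fixes A M F G Z X0 :: "real^'n^'n" and B :: "real^'n"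
  assumes "stable_matrix A"
    and "psd Z"
    and "Qop A B M F G Z \<succeq> 0"
    and "X0 \<succeq> Z"
    and "Qop A B M F G X0 \<preceq> 0"
  shows "(\<exists>!X. fixed_point_sequence A B M F G X0 X) \<and>
    (\<forall>X. fixed_point_sequence A B M F G X0 X \<longrightarrow>
      (\<forall>k. X k \<succeq> X (Suc k) \<and> X k \<succeq> Z \<and> Qop A B M F G (X k) \<preceq> 0) \<and>
      (\<exists>Xs. X \<longlonglongrightarrow> Xs \<and> Qop A B M F G Xs = 0 \<and> psd Xs \<and> (pd Z \<longrightarrow> pd Xs) \<and>
        (is_upper_bound X0 (solutions A B M F G) \<longrightarrow>
           is_maximal Xs (solutions A B M F G)) \<and>
        (is_upper_bound X0 (psd_solutions A B M F G) \<longrightarrow>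
           is_greatest Xs (psd_solutions A B M F G))))"
proof (rule conjI[OF ex1_fixed_point_sequence[OF assms(1)]], intro allI impI)
  fix X
  assume X: "fixed_point_sequence A B M F G X0 X"
  \<comment> \<open>\<open>Y\<close> is kept general to cover both \<open>Z\<close> and the positive
    semidefinite solutions below \<open>X0\<close>.\<close>
  have ge: "X k \<succeq> Y" if "psd Y" "psd (Qop A B M F G Y)" "X0 \<succeq> Y" for Y k
    using fixed_point_sequence_ge[OF assms(1) X that(1,2)] that
    by (intro loewner_geI psd_imp_symmetric) (auto simp: loewner_ge_def)
  have geZ: "X k \<succeq> Z" for k
    using assms by (intro ge) (simp_all add: loewner_ge_0_iff)
  have X_psd: "psd (X k)" for k
    by (rule loewner_ge_psd[OF geZ assms(2)])
  have dec: "psd (X k - X (Suc k))" "psd (- Qop A B M F G (X k))" for k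
    using fixed_point_sequence_decreasing[OF assms(1) X _ X_psd] assms(5) by (auto simp: loewner_le_0_iff)
  obtain Xs where lim: "X \<longlonglongrightarrow> Xs"
    using convergent_decreasing_psd[of X Z] X_psd dec geZ by (auto simp: psd_imp_symmetric loewner_ge_def)
  have Xs_ge: "Xs \<succeq> Y" if "psd Y" "psd (Qop A B M F G Y)" "X0 \<succeq> Y" for Y
  proof (intro loewner_geI psd_imp_symmetric)
    show "psd (Xs - Y)"
      by (rule psd_limit[OF tendsto_diff[OF lim tendsto_const]])
        (use ge[OF that] in \<open>simp add: loewner_ge_def\<close>)
  qed fact
  have Xs: "Qop A B M F G Xs = 0" "psd Xs"
    using fixed_point_sequence_limit[OF X lim] psd_limit[OF lim X_psd] .
  have "Xs \<succeq> Z"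
    using assms by (intro Xs_ge) (simp_all add: loewner_ge_0_iff)
  have maximal: "is_maximal Xs (solutions A B M F G)" if "is_upper_bound X0 (solutions A B M F G)"
    unfolding is_maximal_def
  proof (intro conjI ballI impI)
    show "Xs \<in> solutions A B M F G"
      using Xs by (simp add: solutions_def psd_imp_symmetric)
    fix Y
    assume Y: "Y \<in> solutions A B M F G" "Y \<succeq> Xs"
    \<comment> \<open>Lying above the positive semidefinite \<open>Xs\<close>, the solution
      \<open>Y\<close> is itself positive semidefinite; being below \<open>X0\<close> as well, it is
      below the limit.\<close>
    have "Xs \<succeq> Y"
      using Y that Xs(2) loewner_ge_psd[OF Y(2)]
      by (intro Xs_ge) (auto simp: solutions_def is_upper_bound_def psd_0)
    with Y(2) show "Y = Xs" by (rule loewner_ge_antisym)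
  qed
  have greatest: "is_greatest Xs (psd_solutions A B M F G)" if "is_upper_bound X0 (psd_solutions A B M F G)"
    unfolding is_greatest_def is_upper_bound_def
  proof (intro conjI ballI)
    show "Xs \<in> psd_solutions A B M F G"
      using Xs by (simp add: psd_solutions_def)
    show "Xs \<succeq> Y" if "Y \<in> psd_solutions A B M F G" for Y
      using that \<open>is_upper_bound X0 _\<close>
      by (intro Xs_ge) (auto simp: psd_solutions_def is_upper_bound_def psd_0)
  qed
  have "X k \<succeq> X (Suc k) \<and> X k \<succeq> Z \<and> Qop A B M F G (X k) \<preceq> 0" for k
    using geZ dec(2) loewner_geI[OF psd_imp_symmetric[OF X_psd] dec(1)] by (simp add: loewner_le_0_iff)
  moreover have "pd Z \<longrightarrow> pd Xs"
    using loewner_ge_pd \<open>Xs \<succeq> Z\<close> by blast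
  ultimately show "(\<forall>k. X k \<succeq> X (Suc k) \<and> X k \<succeq> Z \<and> Qop A B M F G (X k) \<preceq> 0) \<and>
      (\<exists>Xs. X \<longlonglongrightarrow> Xs \<and> Qop A B M F G Xs = 0 \<and> psd Xs \<and> (pd Z \<longrightarrow> pd Xs) \<and>
        (is_upper_bound X0 (solutions A B M F G) \<longrightarrow>
           is_maximal Xs (solutions A B M F G)) \<and>
        (is_upper_bound X0 (psd_solutions A B M F G) \<longrightarrow>
           is_greatest Xs (psd_solutions A B M F G)))"
    using lim Xs maximal greatest by blast
qed

end
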